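(* If $[X,R]\in\mathbf{R}(n)$, then $[X,R]$ does not contain any subposet isomorphic to $\mathbf{2}+\mathbf{2}$ or to $Z_4$.
   Context: For a finite set $X$, let $\mathcal{D}=\{(x,x)\mid x\in X\}$; for a binary relation $\theta$ on $X$ let $\overline{\theta}=\theta\cup\theta^{-1}$; for binary relations $A,B$ on $X$, $A\circ B=\{(x,z)\mid \exists y\in X:\ xAy \text{ and } yBz\}$. Let $\mathcal{O}(X)$ be the set of strict order relations on $X$ (irreflexive and transitive binary relations). A Catalan pair on $X$ is an ordered pair $(S,R)$ of binary relations on $X$ such that: (ord S) $S\in\mathcal{O}(X)$; (ord R) $R\in\mathcal{O}(X)$; (tot) $\overline{R}\cup\overline{S}=X^2\setminus\mathcal{D}$; (inters) $\overline{R}\cap\overline{S}=\emptyset$; (comp) $S\circ R\subseteq R$. $[X,R]$ denotes the poset on $X$ with strict order $R$. $\mathbf{R}(n)$ is the set of posets $[X,R]$ with $|X|=n$ for which there exists $S$ such that $(S,R)$ is a Catalan pair on $X$. A subposet is a subset with the induced order. $\mathbf{2}+\mathbf{2}$ is the disjoint union (direct sum) of two 2-element chains: four elements $x,y,z,t$ whose only order relations are $x<y$ and $z<t$. $Z_4$ (the fence of order 4) has four elements $x,y,z,t$ whose only order relations are $x<y$, $x<t$, $z<t$. *)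

theory Defs
  imports Main
begin

definition strict_orders :: "'a set \<Rightarrow> 'a rel set" where
  "strict_orders X = {R. R \<subseteq> X \<times> X \<and> irrefl R \<and> trans R}"

definition sym_closure :: "'a rel \<Rightarrow> 'a rel" where
  "sym_closure \<theta> = \<theta> \<union> \<theta>\<inverse>"

definition catalan_pair :: "'a set \<Rightarrow> 'a rel \<Rightarrow> 'a rel \<Rightarrow> bool" where
  "catalan_pair X S R \<longleftrightarrow>
     finite X \<and>
     S \<in> strict_orders X \<and>
     R \<in> strict_orders X \<and>
     sym_closure R \<union> sym_closure S = (X \<times> X) - Id_on X \<and>
     sym_closure R \<inter> sym_closure S = {} \<and>
     S O R \<subseteq> R"

text \<open>A poset is a pair of a carrier and a strict order on it. The carrier is kept
  explicitly, since elements comparable to nothing do not occur in the relation.\<close>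

type_synonym 'a poset = "'a set \<times> 'a rel"

definition catalan_posets :: "nat \<Rightarrow> 'a poset set" where
  "catalan_posets n = {(X, R). finite X \<and> card X = n \<and> (\<exists>S. catalan_pair X S R)}"

definition subposet :: "'a poset \<Rightarrow> 'a poset \<Rightarrow> bool" where
  "subposet Q P \<longleftrightarrow> fst Q \<subseteq> fst P \<and> snd Q = snd P \<inter> (fst Q \<times> fst Q)"

definition poset_isomorphic :: "'a poset \<Rightarrow> 'b poset \<Rightarrow> bool" where
  "poset_isomorphic P Q \<longleftrightarrow>
     (\<exists>f. bij_betw f (fst P) (fst Q) \<and>
          (\<forall>x\<in>fst P. \<forall>y\<in>fst P. (x, y) \<in> snd P \<longleftrightarrow> (f x, f y) \<in> snd Q))"

text \<open>In both posets below the elements \<open>x, y, z, t\<close> are represented by \<open>0, 1, 2, 3\<close>.\<close>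

definition two_plus_two :: "nat poset" where
  "two_plus_two = ({0, 1, 2, 3}, {(0, 1), (2, 3)})"

definition fence4 :: "nat poset" where
  "fence4 = ({0, 1, 2, 3}, {(0, 1), (0, 3), (2, 3)})"

end

theory Submission
  imports Defs
begin

text \<open>
  The two posets are excluded for one common reason. Both consist of relations
  \<open>x < y\<close> and \<open>z < t\<close> in which \<open>z\<close> is incomparable to \<open>x\<close> and to \<open>y\<close>, while \<open>y\<close> is
  not below \<open>t\<close>; they differ only in the pair \<open>x, t\<close>. In a Catalan pair \<open>(S, R)\<close>,
  distinct points incomparable for \<open>R\<close> are comparable for \<open>S\<close>, and composing an \<open>S\<close>-step with an
  \<open>R\<close>-step on its right yields an \<open>R\<close>-step. The directions \<open>z S x\<close> and \<open>y S z\<close> would thus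
  put \<open>z\<close> below \<open>y\<close> and \<open>y\<close> below \<open>t\<close>. What remains is \<open>x S z S y\<close>, hence
  \<open>x S y\<close>, which is impossible for the \<open>R\<close>-comparable points \<open>x\<close> and \<open>y\<close>.
\<close>

lemma catalan_pair_incomparable:
  assumes "catalan_pair X S R" and "u \<in> X" "v \<in> X" "u \<noteq> v"
    and "(u, v) \<notin> R" "(v, u) \<notin> R"
  shows "(u, v) \<in> S \<or> (v, u) \<in> S"
proof -
  have "(u, v) \<in> sym_closure R \<union> sym_closure S"
    using assms unfolding catalan_pair_def by auto
  then show ?thesis
    using assms(5,6) unfolding sym_closure_def by auto
qed

text \<open>The pair \<open>x, t\<close> is left unconstrained so that both forbidden posets are covered.\<close>

lemma catalan_pair_no_pattern:
  assumes cp: "catalan_pair X S R"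
    and xy: "(x, y) \<in> R" and zt: "(z, t) \<in> R"
    and xz: "x \<noteq> z" "(x, z) \<notin> R" "(z, x) \<notin> R"
    and yz: "y \<noteq> z" "(y, z) \<notin> R" "(z, y) \<notin> R"
    and yt: "(y, t) \<notin> R"
  shows False
proof -
  have X: "x \<in> X" "y \<in> X" "z \<in> X"
    using cp xy zt unfolding catalan_pair_def strict_orders_def by auto
  have comp: "(u, w) \<in> R" if "(u, v) \<in> S" "(v, w) \<in> R" for u v w
    using cp that unfolding catalan_pair_def by blast
  have "(x, z) \<in> S"
    using catalan_pair_incomparable[OF cp X(1,3) xz] comp[OF _ xy] yz(3) by blast
  moreover have "(z, y) \<in> S"
    using catalan_pair_incomparable[OF cp X(2,3) yz] comp[OF _ zt] yt by blast
  moreover have "trans S"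
    using cp unfolding catalan_pair_def strict_orders_def by blast
  ultimately have "(x, y) \<in> S"
    by (blast dest: transD)
  then show False
    using cp xy unfolding catalan_pair_def sym_closure_def by blast
qed

text \<open>Turns an isomorphic copy of a small concrete poset into named points of the
  ambient one, whose mutual relations can then be read off by simplification.\<close>

lemma isomorphic_subposet_embedding:
  assumes "subposet Q P" and "poset_isomorphic Q K"
  obtains g where "inj_on g (fst K)"
    and "\<And>i j. i \<in> fst K \<Longrightarrow> j \<in> fst K \<Longrightarrow> (g i, g j) \<in> snd P \<longleftrightarrow> (i, j) \<in> snd K"
proof -
  obtain f where bij: "bij_betw f (fst Q) (fst K)"
    and f: "\<forall>x\<in>fst Q. \<forall>y\<in>fst Q. (x, y) \<in> snd Q \<longleftrightarrow> (f x, f y) \<in> snd K"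
    using assms(2) unfolding poset_isomorphic_def by blast
  let ?g = "inv_into (fst Q) f"
  have g: "?g i \<in> fst Q" "f (?g i) = i" if "i \<in> fst K" for i
    using that bij_betwE[OF bij_betw_inv_into[OF bij]] bij_betw_inv_into_right[OF bij] by auto
  show thesis
  proof (rule that)
    show "inj_on ?g (fst K)"
      using bij bij_betw_inv_into bij_betw_imp_inj_on by blast
    show "(?g i, ?g j) \<in> snd P \<longleftrightarrow> (i, j) \<in> snd K" if "i \<in> fst K" "j \<in> fst K" for i j
      using f g[OF that(1)] g[OF that(2)] assms(1) unfolding subposet_def by auto
  qed
qed

theorem proposition4p2:
  fixes X :: "'a set" and R :: "'a rel" and n :: nat
  assumes "(X, R) \<in> catalan_posets n"
  shows "\<not> (\<exists>Q. subposet Q (X, R) \<and>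
               (poset_isomorphic Q two_plus_two \<or> poset_isomorphic Q fence4))"
proof
  assume "\<exists>Q. subposet Q (X, R) \<and>
               (poset_isomorphic Q two_plus_two \<or> poset_isomorphic Q fence4)"
  then obtain Q K where Q: "subposet Q (X, R)" "poset_isomorphic Q K"
    and K: "K = two_plus_two \<or> K = fence4"
    by blast
  obtain S where cp: "catalan_pair X S R"
    using assms unfolding catalan_posets_def by blast
  obtain g where inj: "inj_on g (fst K)"
    and g: "\<And>i j. i \<in> fst K \<Longrightarrow> j \<in> fst K \<Longrightarrow> (g i, g j) \<in> R \<longleftrightarrow> (i, j) \<in> snd K"
    using isomorphic_subposet_embedding[OF Q] by auto
  have K4: "fst K = {0, 1, 2, 3}"
    using K unfolding two_plus_two_def fence4_def by auto
  have "g 0 \<noteq> g 2" "g 1 \<noteq> g 2"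
    using inj unfolding K4 inj_on_def by auto
  moreover have "(0, 1) \<in> snd K" "(2, 3) \<in> snd K" "(0, 2) \<notin> snd K" "(2, 0) \<notin> snd K"
    "(1, 2) \<notin> snd K" "(2, 1) \<notin> snd K" "(1, 3) \<notin> snd K"
    using K unfolding two_plus_two_def fence4_def by auto
  then have "(g 0, g 1) \<in> R" "(g 2, g 3) \<in> R" "(g 0, g 2) \<notin> R" "(g 2, g 0) \<notin> R"
    "(g 1, g 2) \<notin> R" "(g 2, g 1) \<notin> R" "(g 1, g 3) \<notin> R"
    by (simp_all add: g K4)
  ultimately show False
    using catalan_pair_no_pattern[OF cp] by blast
qed

end
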